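(* Let $n\geq1$ be an integer, let $f\in\mathcal{A}_n$ with $f(z)\neq0$ for $z\in\mathbb{U}\setminus\{0\}$, and let $\lambda,\mu,c\in\mathbb{C}$ with $\lambda\neq0$, $\mu\neq0$ and $0<\operatorname{Re}(c-\mu)<n$, such that $$f'(z)\left(\frac{z}{f(z)}\right)^{1+\mu}\prec 1+\lambda z\qquad(z\in\mathbb{U}).$$ Let $$G(z)=\frac{c-\mu}{z^{c-\mu}}\int_0^z\left(\frac{t}{f(t)}\right)^{\mu}t^{c-\mu-1}\,dt,$$ assume $G(z)\neq0$ on $\mathbb{U}$, and let $F(z)=z\,[G(z)]^{-1/\mu}$ (branch with value $1$ of $G^{-1/\mu}$ at $z=0$). Put $$\ell_1=|\lambda|\,\frac{|c-\mu|}{|n-(c-\mu)|},\qquad \ell_2=\ell_1\,\frac{|\mu|}{|n-\mu|}.$$ Then: (1) If $\operatorname{Re}(\mu)<n$ and $|c-\mu|\,|\lambda|\leq\dfrac{|n-\mu|\,|n-(c-\mu)|}{\sqrt{|n-\mu|^2+|\mu|^2}}$, then $\operatorname{Re}\big(zF'(z)/F(z)\big)>0$ on $\mathbb{U}$, i.e. $F$ is starlike. (2) If $\operatorname{Re}(\mu)<n/2$ and $\ell_1\leq\dfrac{|n-\mu|}{\sqrt{|n-\mu|^2+|\mu|^2}}$, then $\operatorname{Re}\big(zF'(z)/F(z)\big)>\alpha_0$ on $\mathbb{U}$ (so $F$ is starlike of order $\alpha$ for every $0\le\alpha\leq\alpha_0$), where $$\alpha_0=\begin{cases}\dfrac{1-\ell_1}{1+\ell_2},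 & \text{if } 0<\ell_1\leq\dfrac{|n-\mu|}{|n-\mu|+|\mu|},\\[2mm] \dfrac{1-(\ell_1^2+\ell_2^2)}{2(1-\ell_2^2)}, & \text{if } \dfrac{|n-\mu|}{|n-\mu|+|\mu|}\leq\ell_1\leq\dfrac{|n-\mu|}{\sqrt{|n-\mu|^2+|\mu|^2}}.\end{cases}$$ (3) If $\operatorname{Re}(\mu)<n/2$ and $|c-\mu|\,|\lambda|\leq\dfrac{|n-(c-\mu)|\,|n-\mu|}{|n-\mu|+2|\mu|}$, then $$\left|\frac{zF'(z)}{F(z)}-1\right|<\frac{(|n-\mu|+|\mu|)\,|c-\mu|\,|\lambda|}{|n-(c-\mu)|\,|n-\mu|-|c-\mu|\,|\mu|\,|\lambda|}\leq1\qquad(z\in\mathbb{U}).$$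
   Context: $\mathbb{U}=\{z\in\mathbb{C}:|z|<1\}$. For an integer $n\geq1$, $\mathcal{A}_n$ is the class of functions $f(z)=z+a_{n+1}z^{n+1}+a_{n+2}z^{n+2}+\cdots$ analytic in $\mathbb{U}$ with $a_{n+1}\neq0$. A function $F$ analytic in $\mathbb{U}$ with $F(0)=0$, $F'(0)=1$ is starlike of order $\alpha$ ($0\le\alpha<1$) if $\operatorname{Re}(zF'(z)/F(z))>\alpha$ on $\mathbb{U}$. Powers such as $(z/f(z))^{\mu}$ are defined as $\exp(\mu\log(z/f(z)))$ using the branch of $\log(z/f(z))$ (analytic on $\mathbb{U}$) equal to $0$ at $z=0$; similarly $z^{-(c-\mu)}\int_0^z(\cdots)t^{c-\mu-1}dt$ is understood with $t^{c-\mu-1}=\exp((c-\mu-1)\log t)$ along the segment from $0$ to $z$ and the corresponding branch of $z^{c-\mu}$, so that $G$ is analytic in $\mathbb{U}$ with $G(0)=1$. For $F,G$ analytic in $\mathbb{U}$, $F\prec G$ means there is an analytic $w$ in $\mathbb{U}$ with $w(0)=0$, $|w(z)|<1$, and $F=G\circ w$; for $\lambda\neq0$, $q\prec1+\lambda z$ means $q(0)=1$ and $|q(z)-1|<|\lambda|$ on $\mathbb{U}$. *)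

theory Defs
  imports "HOL-Analysis.Analysis"
begin

text \<open>The class A_n: f(z) = z + a_{n+1} z^{n+1} + ... analytic in the unit disc,
  with a_{n+1} nonzero. Taylor coefficients are expressed through higher derivatives
  at 0 (a_k = f^(k)(0)/k!).\<close>
definition class_A :: "nat \<Rightarrow> (complex \<Rightarrow> complex) \<Rightarrow> bool" where
  "class_A n f \<longleftrightarrow> f holomorphic_on ball 0 1 \<and> f 0 = 0 \<and> deriv f 0 = 1 \<and>
     (\<forall>k. 2 \<le> k \<and> k \<le> n \<longrightarrow> (deriv ^^ k) f 0 = 0) \<and> (deriv ^^ (n + 1)) f 0 \<noteq> 0"

definition subordinate :: "(complex \<Rightarrow> complex) \<Rightarrow> (complex \<Rightarrow> complex) \<Rightarrow> bool" where
  "subordinate F G \<longleftrightarrow> (\<exists>w. w holomorphic_on ball 0 1 \<and> w 0 = 0 \<and>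
     (\<forall>z\<in>ball 0 1. norm (w z) < 1) \<and> (\<forall>z\<in>ball 0 1. F z = G (w z)))"

end

theory Submission
  imports Defs "HOL-Complex_Analysis.Complex_Analysis"
begin

text \<open>
  Write \<open>\<gamma> = c - \<mu>\<close>, \<open>g = (z/f)\<^sup>\<mu>\<close> and \<open>P = G - zG'/\<mu>\<close>. Then \<open>zF'/F = P/G\<close>, and
  \<open>zG' + \<gamma>G = \<gamma>g\<close> together with \<open>g - zg'/\<mu> = f' (z/f)\<^bsup>1+\<mu>\<^esup>\<close> gives
  \<open>P + zP'/\<gamma> = f' (z/f)\<^bsup>1+\<mu>\<^esup>\<close>. All these functions are \<open>1 + O(z\<^sup>n)\<close>, so a
  Jack-type maximum principle for \<open>h \<mapsto> \<alpha>h + zh'\<close> yields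
  \<open>|P - 1| \<le> |\<lambda>| |\<gamma>| / |n + \<gamma>| < \<ell>\<^sub>1\<close>, where \<open>|n - \<gamma>| < |n + \<gamma>|\<close> since \<open>Re \<gamma> > 0\<close>, and
  then \<open>|G - 1| \<le> \<ell>\<^sub>2\<close>. The estimates for \<open>P/G\<close> are elementary: with \<open>t = 1/|G|\<close>, the
  quantity \<open>Re (P/G)\<close> exceeds a quadratic polynomial in \<open>t\<close>, whose minimum over
  \<open>t \<ge> 1/(1 + \<ell>\<^sub>2)\<close> lies at the end point or at the vertex.
\<close>

section \<open>A maximum principle for the operator
  \<open>\<alpha> * h z + z * deriv h z\<close>\<close>

text \<open>At a point where |h| is maximal on a circle, |h| cannot grow along an inward spiral. The
  sign of that derivative prevents \<open>z0 * deriv h z0\<close> from cancelling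
  \<open>\<alpha> * h z0\<close>. The weight \<open>z ^ n\<close> costs only a factor
  \<open>r ^ n\<close>, which disappears as r tends to 1.\<close>

lemma norm_le_of_Euler_operator_bound:
  fixes h :: "complex \<Rightarrow> complex"
  assumes hol: "h holomorphic_on ball 0 1" and \<alpha>: "Re \<alpha> > 0"
    and bound: "\<And>z. z \<in> ball 0 1 \<Longrightarrow> norm (z ^ n * (\<alpha> * h z + z * deriv h z)) \<le> K"
    and z: "z \<in> ball 0 1"
  shows "norm (h z) \<le> K / norm \<alpha>"
proof -
  have \<alpha>0: "\<alpha> \<noteq> 0" using \<alpha> by auto
  have main: "norm (h z) * norm \<alpha> * r ^ n \<le> K" if r: "norm z < r" "r < 1" for r
  proof -
    have r0: "r > 0" using r by (meson norm_ge_zero order_le_less_trans)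
    have sub: "cball 0 r \<subseteq> ball (0::complex) 1" using r by auto
    have cont: "continuous_on (cball 0 r) h"
      using hol holomorphic_on_imp_continuous_on continuous_on_subset sub by blast
    have "\<exists>z0\<in>sphere 0 r. \<forall>y\<in>sphere 0 r. norm (h y) \<le> norm (h z0)"
      using r0 by (intro continuous_attains_sup continuous_intros continuous_on_subset[OF cont]) auto
    then obtain z0 where z0: "norm z0 = r" and mx: "\<And>y. norm y = r \<Longrightarrow> norm (h y) \<le> norm (h z0)"
      by auto
    have le: "norm (h y) \<le> norm (h z0)" if "y \<in> cball 0 r" for y
    proof (rule maximum_modulus_frontier[of h "cball 0 r"])
      show "h holomorphic_on interior (cball 0 r)"
        using hol sub by (meson holomorphic_on_subset interior_subset order_trans)
    qed (use that cont mx in auto)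
    \<comment> \<open>Moving from the maximum point \<open>z0\<close> along \<open>z0 * exp (- s * cnj \<alpha>)\<close> stays in the disc; this
      direction makes \<open>\<alpha> * h z0\<close> contribute the full \<open>norm \<alpha> * norm (h z0)\<close>.\<close>
    define \<beta> where "\<beta> = cnj \<alpha>"
    have z0b: "z0 \<in> ball 0 1" using z0 r by simp
    have dh: "(h has_field_derivative deriv h z0) (at z0)"
      using hol z0b holomorphic_derivI open_ball by blast
    define D where "D = - \<beta> * z0 * deriv h z0"
    \<comment> \<open>The path is differentiated in a complex parameter first, so that the chain
      rule applies, and then restricted to real s.\<close>
    have "((\<lambda>s. h (z0 * exp (- (s * \<beta>)))) has_field_derivative D) (at (of_real 0))"
    proof -
      have "((\<lambda>s. z0 * exp (- (s * \<beta>))) has_field_derivative (- \<beta> * z0)) (at 0)"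
        by (auto intro!: derivative_eq_intros)
      then show ?thesis
        using DERIV_chain2[of h "deriv h z0" "\<lambda>s. z0 * exp (- (s * \<beta>))" 0 "- \<beta> * z0" UNIV] dh
        by (simp add: D_def mult_ac)
    qed
    then have dv: "((\<lambda>s. h (z0 * exp (- (of_real s * \<beta>)))) has_vector_derivative D) (at 0)"
      by (rule has_vector_derivative_real_field)
    \<comment> \<open>\<open>\<psi>\<close> replaces the squared norm of h along the path: it agrees
      with it at s = 0, is bounded by that value for s >= 0, and is a real part of something linear
      in h, hence easy to differentiate.\<close>
    define \<psi> where "\<psi> = (\<lambda>s. Re (cnj (h z0) * h (z0 * exp (- (of_real s * \<beta>)))))"
    have "(\<psi> has_real_derivative Re (cnj (h z0) * D)) (at 0)"
      unfolding \<psi>_def has_real_derivative_iff_has_vector_derivative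
      using bounded_linear.has_vector_derivative[OF bounded_linear_Re
          has_vector_derivative_mult_right[OF dv, of "cnj (h z0)"]] by simp
    moreover have "\<psi> s \<le> \<psi> 0" if "s \<ge> 0" for s
    proof -
      have "exp (- (s * Re \<alpha>)) \<le> 1" using that \<alpha> by simp
      then have "z0 * exp (- (of_real s * \<beta>)) \<in> cball 0 r"
        using z0 r0 by (simp add: norm_mult \<beta>_def mult_left_le)
      then have "norm (h (z0 * exp (- (of_real s * \<beta>)))) \<le> norm (h z0)" by (rule le)
      then have "norm (cnj (h z0) * h (z0 * exp (- (of_real s * \<beta>)))) \<le> (norm (h z0))\<^sup>2"
        by (simp add: norm_mult power2_eq_square mult_left_mono)
      moreover have "\<psi> 0 = (norm (h z0))\<^sup>2"
        unfolding \<psi>_def by (simp add: cmod_power2) (simp add: power2_eq_square)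
      ultimately show ?thesis
        unfolding \<psi>_def using complex_Re_le_cmod order_trans by metis
    qed
    ultimately have D0: "Re (cnj (h z0) * D) \<le> 0"
      using DERIV_pos_inc_right[of \<psi> "Re (cnj (h z0) * D)" 0]
      by (metis add_0 dense leD less_eq_real_def not_le)
    have eq: "(cnj (h z0) * \<beta>) * (\<alpha> * h z0 + z0 * deriv h z0)
        = of_real ((norm \<alpha> * norm (h z0))\<^sup>2) - cnj (h z0) * D"
      unfolding D_def \<beta>_def power_mult_distrib of_real_mult complex_norm_square
      by (simp add: algebra_simps)
    have "(norm \<alpha> * norm (h z0))\<^sup>2 \<le> Re ((cnj (h z0) * \<beta>) * (\<alpha> * h z0 + z0 * deriv h z0))"
      unfolding eq using D0 by simp
    also have "\<dots> \<le> norm ((cnj (h z0) * \<beta>) * (\<alpha> * h z0 + z0 * deriv h z0))"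
      by (rule complex_Re_le_cmod)
    also have "\<dots> = (norm \<alpha> * norm (h z0)) * norm (\<alpha> * h z0 + z0 * deriv h z0)"
      by (simp add: norm_mult \<beta>_def)
    finally have "norm \<alpha> * norm (h z0) \<le> norm (\<alpha> * h z0 + z0 * deriv h z0)"
      using \<alpha>0 by (cases "h z0 = 0") (auto simp: power2_eq_square)
    then have "norm \<alpha> * norm (h z0) * r ^ n \<le> norm (\<alpha> * h z0 + z0 * deriv h z0) * r ^ n"
      using r0 by (intro mult_right_mono) auto
    also have "\<dots> \<le> K"
      using bound[OF z0b] z0 by (simp add: norm_mult norm_power mult.commute)
    finally have "norm \<alpha> * norm (h z0) * r ^ n \<le> K" .
    moreover have "norm (h z) * norm \<alpha> * r ^ n \<le> norm \<alpha> * norm (h z0) * r ^ n"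
      using le[of z] r r0 by (simp add: mult.commute mult_left_mono)
    ultimately show ?thesis by simp
  qed
  have "((\<lambda>r. norm (h z) * norm \<alpha> * r ^ n) \<longlongrightarrow> norm (h z) * norm \<alpha> * 1 ^ n) (at_left (1::real))"
    by (intro tendsto_intros)
  moreover have "eventually (\<lambda>r. norm (h z) * norm \<alpha> * r ^ n \<le> K) (at_left (1::real))"
    using eventually_at_left_real[of "norm z" 1] z
    by (auto elim!: eventually_mono intro!: main)
  ultimately have "norm (h z) * norm \<alpha> \<le> K"
    using tendsto_upperbound[of _ _ "at_left (1::real)" K] by fastforce
  then show ?thesis using \<alpha>0 by (simp add: field_simps)
qed

section \<open>Factoring powers of z out of holomorphic functions\<close>

text \<open>No differentiability is assumed: both functions admit the same derivatives at each
  point, so \<open>deriv\<close> makes the same choice for both.\<close>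

lemma deriv_diff_const [simp]:
  fixes \<phi> :: "complex \<Rightarrow> complex"
  shows "deriv (\<lambda>z. \<phi> z - c) = deriv \<phi>"
proof -
  have "((\<lambda>z. \<phi> z - c) has_field_derivative D) (at z) \<longleftrightarrow> (\<phi> has_field_derivative D) (at z)" for D z
    using DERIV_diff[OF _ DERIV_const[of c], of \<phi> D z UNIV]
      DERIV_add[OF _ DERIV_const[of c], of "\<lambda>z. \<phi> z - c" D z UNIV] by auto
  then show ?thesis by (simp add: deriv_def fun_eq_iff)
qed

lemma holomorphic_factor_0:
  fixes \<phi> :: "complex \<Rightarrow> complex"
  assumes "\<phi> holomorphic_on ball 0 1" "\<phi> 0 = 0"
  obtains k where "k holomorphic_on ball 0 1" "\<And>z. z \<in> ball 0 1 \<Longrightarrow> \<phi> z = z * k z"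
proof
  show "(\<lambda>z. if z = 0 then deriv \<phi> 0 else (\<phi> z - \<phi> 0) / (z - 0)) holomorphic_on ball 0 1"
    by (rule pole_lemma[OF assms(1)]) auto
qed (use assms in auto)

text \<open>Pulling \<open>z ^ n\<close> through z d/dz shifts \<alpha> to n + \<alpha>; this is how
  the order of vanishing enters the constants of the theorem.\<close>

lemma Euler_operator_power_mult:
  fixes k :: "complex \<Rightarrow> complex"
  assumes "k holomorphic_on ball 0 1" "z \<in> ball 0 1" 
    and "\<And>z. z \<in> ball 0 1 \<Longrightarrow> \<phi> z = z ^ n * k z"
  shows "z * deriv \<phi> z + \<alpha> * \<phi> z = z ^ n * ((of_nat n + \<alpha>) * k z + z * deriv k z)"
proof -
  have dk: "(k has_field_derivative deriv k z) (at z)"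
    using assms holomorphic_derivI open_ball by blast
  have "((\<lambda>z. z ^ n * k z) has_field_derivative (of_nat n * z ^ (n - 1) * k z + z ^ n * deriv k z)) (at z)"
    by (auto intro!: derivative_eq_intros dk)
  then have "(\<phi> has_field_derivative (of_nat n * z ^ (n - 1) * k z + z ^ n * deriv k z)) (at z)"
    by (rule DERIV_cong_ev[THEN iffD1, rotated -1])
      (use assms eventually_nhds_in_open[of "ball 0 1" z] in \<open>auto elim!: eventually_mono\<close>)
  then have d: "deriv \<phi> z = of_nat n * z ^ (n - 1) * k z + z ^ n * deriv k z"
    by (rule DERIV_imp_deriv)
  \<comment> \<open>For n = 0 the exponent n - 1 is truncated, but both sides are then 0.\<close>
  have "z * (of_nat n * z ^ (n - 1)) = of_nat n * z ^ n"
    by (cases n) auto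
  then have "z * deriv \<phi> z = of_nat n * z ^ n * k z + z ^ n * (z * deriv k z)"
    unfolding d by (simp only: distrib_left mult.assoc[symmetric]) (simp add: mult_ac)
  then show ?thesis
    using assms(3)[OF assms(2)] by (simp add: algebra_simps)
qed

text \<open>Continuity extends the identity to 0, so powers of z may be cancelled before evaluating
  at 0.\<close>

lemma ball_minus_zero_eq_imp_eq:
  fixes u v :: "complex \<Rightarrow> complex"
  assumes "u holomorphic_on ball 0 1" "v holomorphic_on ball 0 1"
    and "\<And>z. z \<in> ball 0 1 \<Longrightarrow> z \<noteq> 0 \<Longrightarrow> u z = v z" and "z \<in> ball 0 1"
  shows "u z = v z"
proof (cases "z = 0")
  case True
  have u: "(u \<longlongrightarrow> u 0) (at 0)" and v: "(v \<longlongrightarrow> v 0) (at 0)"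
    using assms(1,2) by (meson centre_in_ball continuous_on_eq_continuous_at holomorphic_on_imp_continuous_on
        isCont_def open_ball zero_less_one)+
  have "eventually (\<lambda>z. u z = v z) (at 0)"
    using eventually_at_ball[of 1 "0::complex" UNIV] assms(3)
    by (auto simp: eventually_at_filter elim!: eventually_mono)
  then have "u 0 = v 0"
    using tendsto_unique[OF _ u] v tendsto_cong[of u v "at 0" "v 0"] by auto
  then show ?thesis using True by simp
qed (use assms in auto)

text \<open>One power of z is gained at a time. If \<open>\<phi> z = z ^ j * k z\<close> with j < n,
  cancelling \<open>z ^ j\<close> in the equation and setting z = 0 gives (j + \<alpha>) k(0) = 0,
  so k has another factor z. This stands in for comparing Taylor coefficients.\<close>

lemma Euler_operator_factor_power:
  fixes \<phi> :: "complex \<Rightarrow> complex"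
  assumes hol: "\<phi> holomorphic_on ball 0 1" and \<phi>0: "\<phi> 0 = 0" and \<alpha>: "Re \<alpha> \<ge> 0"
    and v: "v holomorphic_on ball 0 1"
    and eq: "\<And>z. z \<in> ball 0 1 \<Longrightarrow> z * deriv \<phi> z + \<alpha> * \<phi> z = z ^ n * v z"
  obtains k where "k holomorphic_on ball 0 1" "\<And>z. z \<in> ball 0 1 \<Longrightarrow> \<phi> z = z ^ n * k z"
proof -
  have "\<exists>k. k holomorphic_on ball 0 1 \<and> (\<forall>z\<in>ball 0 1. \<phi> z = z ^ j * k z)" if "j \<le> n" for j
    using that
  proof (induction j)
    case 0
    then show ?case using hol by auto
  next
    case (Suc j)
    then obtain k where k: "k holomorphic_on ball 0 1" "\<And>z. z \<in> ball 0 1 \<Longrightarrow> \<phi> z = z ^ j * k z"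
      by auto
    \<comment> \<open>Since \<alpha> = 0 is allowed, j + \<alpha> may vanish at j = 0; there the
      assumption on \<open>\<phi> 0\<close> is used instead.\<close>
    have "k 0 = 0"
    proof (cases "j = 0")
      case True
      then show ?thesis using k(2)[of 0] \<phi>0 by simp
    next
      case False
      have "(of_nat j + \<alpha>) * k 0 + 0 * deriv k 0 = 0 ^ (n - j) * v 0"
      proof (rule ball_minus_zero_eq_imp_eq[where z=0])
        fix z :: complex assume z: "z \<in> ball 0 1" "z \<noteq> 0"
        have "z ^ j * ((of_nat j + \<alpha>) * k z + z * deriv k z) = z ^ (j + (n - j)) * v z"
          using Euler_operator_power_mult[OF k(1) z(1) k(2)] eq[OF z(1)] Suc.prems by simp
        then show "(of_nat j + \<alpha>) * k z + z * deriv k z = z ^ (n - j) * v z"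
          using z by (simp add: power_add)
      qed (auto intro!: holomorphic_intros k v)
      moreover have "of_nat j + \<alpha> \<noteq> 0"
        using \<alpha> False by (auto simp: complex_eq_iff)
      ultimately show ?thesis using Suc.prems by (simp add: power_0_left)
    qed
    then obtain k' where "k' holomorphic_on ball 0 1" "\<And>z. z \<in> ball 0 1 \<Longrightarrow> k z = z * k' z"
      using holomorphic_factor_0[OF k(1)] by blast
    then show ?case using k(2) by (intro exI[of _ k']) auto
  qed
  then show ?thesis using that by blast
qed

text \<open>Induction through the derivative: a factorization of \<phi>' is lifted to \<phi> by the
  preceding lemma with \<alpha> = 0.\<close>

lemma holomorphic_factor_power:
  fixes \<phi> :: "complex \<Rightarrow> complex"
  assumes "\<phi> holomorphic_on ball 0 1" "\<And>k. k < n \<Longrightarrow> (deriv ^^ k) \<phi> 0 = 0"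
  shows "\<exists>k. k holomorphic_on ball 0 1 \<and> (\<forall>z\<in>ball 0 1. \<phi> z = z ^ n * k z)"
  using assms
proof (induction n arbitrary: \<phi>)
  case 0
  then show ?case by auto
next
  case (Suc n)
  have "(deriv ^^ k) (deriv \<phi>) 0 = 0" if "k < n" for k
    using Suc.prems(2)[of "Suc k"] that by (simp add: funpow_swap1)
  then obtain k where k: "k holomorphic_on ball 0 1" "\<forall>z\<in>ball 0 1. deriv \<phi> z = z ^ n * k z"
    using Suc.IH[of "deriv \<phi>"] Suc.prems(1) by (auto intro: holomorphic_deriv)
  show ?case
    by (rule Euler_operator_factor_power[OF Suc.prems(1) _ _ k(1), of 0 "Suc n"])
      (use Suc.prems(2)[of 0] k(2) in auto)
qed

section \<open>The differential equation satisfied by the integral transform\<close>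

text \<open>
  \<open>Gnz\<close> makes the integrals converge: the integral of a non-integrable function is 0.
\<close>
lemma integral_transform_ODE:
  fixes g G :: "complex \<Rightarrow> complex"
  assumes g: "g holomorphic_on ball 0 1" and G: "G holomorphic_on ball 0 1"
    and Gnz: "\<And>z. z \<in> ball 0 1 - {0} \<Longrightarrow> G z \<noteq> 0"
    and G_eq: "\<And>z. z \<in> ball 0 1 - {0} \<Longrightarrow> G z = \<gamma> / (z powr \<gamma>) *
        integral {0..1} (\<lambda>s::real. g (of_real s * z) * (of_real s * z) powr (\<gamma> - 1) * z)"
    and z: "z \<in> ball 0 1 - {0}"
  shows "z * deriv G z + \<gamma> * G z = \<gamma> * g z"
proof -
  \<comment> \<open>For real s > 0 the principal logarithm satisfies Ln(sw) = Ln s + Ln w even on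
    the branch cut, so the powers of w cancel and a branch-free formula remains. At s = 0 both
    integrands vanish because \<open>0 powr _ = 0\<close>.\<close>
  have G_eq': "G w = \<gamma> * integral {0..1} (\<lambda>s::real. g (of_real s * w) * of_real s powr (\<gamma> - 1))"
    if w: "w \<in> ball 0 1 - {0}" for w
  proof -
    have "(of_real s * w) powr (\<gamma> - 1) * w = w powr \<gamma> * of_real s powr (\<gamma> - 1)" if "s \<in> {0..1}" for s :: real
    proof (cases "s = 0")
      case False
      then have "Ln (of_real s * w) = Ln (of_real s) + Ln w"
        using that w by (simp add: Ln_times_of_real Ln_of_real)
      then have "(of_real s * w) powr (\<gamma> - 1) = of_real s powr (\<gamma> - 1) * w powr (\<gamma> - 1)"
        using False w by (simp add: powr_def distrib_left exp_add)
      moreover have "w powr (\<gamma> - 1) * w = w powr \<gamma>"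
        using w by (simp add: powr_diff)
      ultimately show ?thesis by (simp add: mult_ac)
    qed auto
    then have "integral {0..1} (\<lambda>s::real. g (of_real s * w) * (of_real s * w) powr (\<gamma> - 1) * w)
      = integral {0..1} (\<lambda>s::real. w powr \<gamma> * (g (of_real s * w) * of_real s powr (\<gamma> - 1)))"
      by (intro integral_cong) (simp add: mult_ac)
    then show ?thesis
      using G_eq[OF w] w by simp
  qed
  \<comment> \<open>The square root places z strictly inside the segment from 0 to
    \<open>\<zeta>\<close>, with \<open>\<zeta>\<close> still in the disc, so two-sided derivatives
    at \<open>\<rho>\<close> are available.\<close>
  define \<rho> where "\<rho> = sqrt (norm z)"
  have \<rho>: "0 < \<rho>" "\<rho> < 1" and \<rho>2: "\<rho> * \<rho> = norm z"
    using z by (auto simp: \<rho>_def)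
  define \<zeta> where "\<zeta> = z / of_real \<rho>"
  have z_eq: "z = of_real \<rho> * \<zeta>" using \<rho> by (simp add: \<zeta>_def)
  have "norm \<zeta> = \<rho>" using \<rho> \<rho>2 by (simp add: \<zeta>_def norm_divide field_simps)
  then have \<zeta>: "\<zeta> \<in> ball 0 1 - {0}" using \<rho> by auto
  define \<phi> where "\<phi> = (\<lambda>s::real. g (of_real s * \<zeta>) * of_real s powr (\<gamma> - 1))"
  have int: "\<phi> integrable_on {0..1}"
    using G_eq'[OF \<zeta>] Gnz[OF \<zeta>] not_integrable_integral unfolding \<phi>_def by fastforce
  have rz: "of_real r * \<zeta> \<in> ball 0 1 - {0}" if "0 < r" "r \<le> 1" for r
    using \<zeta> that le_less_trans[OF mult_left_le_one_le[of "norm \<zeta>" r]] by (auto simp: norm_mult)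
  \<comment> \<open>Rescaling the interval moves the variable into the upper limit. Differentiating
    both sides at r = \<open>\<rho>\<close> then yields the equation at z.\<close>
  have I: "of_real r powr \<gamma> * G (of_real r * \<zeta>) = \<gamma> * integral {0..r} \<phi>" if r: "0 < r" "r < 1" for r
  proof -
    have "(\<phi> has_integral integral {0..r} \<phi>) {0..r}"
      using integrable_on_subinterval[OF int, of 0 r] r by auto
    then have "((\<lambda>s. \<phi> (r * s)) has_integral integral {0..r} \<phi> /\<^sub>R r) {0..1}"
      using has_integral_stretch_real[of \<phi> "integral {0..r} \<phi>" 0 r r] r by (simp add: inverse_eq_divide)
    moreover have "\<phi> (r * s) = of_real r powr (\<gamma> - 1) * (g (of_real s * (of_real r * \<zeta>)) * of_real s powr (\<gamma> - 1))"
      if "s \<in> {0..1}" for s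
      using that r by (simp add: \<phi>_def powr_times_real mult_ac)
    ultimately have "((\<lambda>s. of_real r powr (\<gamma> - 1) * (g (of_real s * (of_real r * \<zeta>)) * of_real s powr (\<gamma> - 1)))
        has_integral integral {0..r} \<phi> /\<^sub>R r) {0..1}"
      by (rule has_integral_eq[rotated])
    from integral_unique[OF this] have "of_real r powr (\<gamma> - 1) * integral {0..1} (\<lambda>s::real. g (of_real s * (of_real r * \<zeta>)) * of_real s powr (\<gamma> - 1))
        = integral {0..r} \<phi> /\<^sub>R r"
      by (simp only: integral_mult_right)
    moreover have "of_real r powr \<gamma> = (of_real r powr (\<gamma> - 1) * of_real r :: complex)"
      using r by (simp add: powr_diff)
    ultimately show ?thesis
      using G_eq'[OF rz[of r]] r by (simp add: scaleR_conv_of_real field_simps)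
  qed
  have dG: "(G has_field_derivative deriv G z) (at z)"
    using G z holomorphic_derivI open_ball by blast
  define D where "D = \<gamma> * of_real \<rho> powr (\<gamma> - 1) * G z + of_real \<rho> powr \<gamma> * (deriv G z * \<zeta>)"
  have "((\<lambda>u. u powr \<gamma> * G (u * \<zeta>)) has_field_derivative D) (at (of_real \<rho>))"
  proof -
    have "((\<lambda>u. u * \<zeta>) has_field_derivative \<zeta>) (at (of_real \<rho>))"
      by (auto intro!: derivative_eq_intros)
    then have "((\<lambda>u. G (u * \<zeta>)) has_field_derivative (deriv G z * \<zeta>)) (at (of_real \<rho>))"
      using DERIV_chain2[of G "deriv G z" "\<lambda>u. u * \<zeta>" "of_real \<rho>" \<zeta> UNIV] dG
      by (simp add: z_eq)
    moreover have "((\<lambda>u. u powr \<gamma>) has_field_derivative \<gamma> * of_real \<rho> powr (\<gamma> - 1)) (at (of_real \<rho>))"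
      using \<rho> by (intro has_field_derivative_powr) (auto simp: complex_nonpos_Reals_iff)
    ultimately show ?thesis
      unfolding D_def using \<rho> by (auto intro!: derivative_eq_intros simp: z_eq)
  qed
  then have "((\<lambda>r. of_real r powr \<gamma> * G (of_real r * \<zeta>)) has_vector_derivative D) (at \<rho>)"
    by (rule has_vector_derivative_real_field)
  then have d1: "((\<lambda>r. \<gamma> * integral {0..r} \<phi>) has_vector_derivative D) (at \<rho>)"
    by (rule has_vector_derivative_transform_within_open[of _ _ _ "{0<..<1}"]) (use \<rho> I in auto)
  \<comment> \<open>\<open>\<phi>\<close> may be unbounded near 0, so the fundamental theorem is
    used in the form that asks for integrability on the interval and continuity at
    \<open>\<rho>\<close> alone.\<close>
  have "isCont \<phi> \<rho>"
  proof -
    have "isCont g (of_real \<rho> * \<zeta>)"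
      using g z unfolding z_eq
      by (metis DiffD1 continuous_on_eq_continuous_at holomorphic_on_imp_continuous_on open_ball)
    then have "isCont (\<lambda>s::real. g (of_real s * \<zeta>)) \<rho>"
      by (intro isCont_o2[where g=g and f="\<lambda>s. of_real s * \<zeta>"]) (auto intro!: continuous_intros)
    then show ?thesis
      unfolding \<phi>_def using \<rho> by (intro continuous_intros) (auto simp: complex_nonpos_Reals_iff)
  qed
  then have "((\<lambda>r. integral {0..r} \<phi>) has_vector_derivative \<phi> \<rho>) (at \<rho> within {0..1})"
    using integral_has_vector_derivative_continuous_at[OF int, of \<rho> "{}"] \<rho>
    by (simp add: continuous_at_imp_continuous_at_within)
  then have "((\<lambda>r. integral {0..r} \<phi>) has_vector_derivative \<phi> \<rho>) (at \<rho>)"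
    using at_within_interior[of \<rho> "{0..1}"] \<rho> by simp
  then have "((\<lambda>r. \<gamma> * integral {0..r} \<phi>) has_vector_derivative \<gamma> * \<phi> \<rho>) (at \<rho>)"
    by (rule has_vector_derivative_mult_right)
  then have "D = \<gamma> * \<phi> \<rho>"
    using d1 vector_derivative_unique_at by blast
  moreover have "of_real \<rho> powr \<gamma> = (of_real \<rho> powr (\<gamma> - 1) * of_real \<rho> :: complex)"
    using \<rho> by (simp add: powr_diff)
  ultimately have "of_real \<rho> powr (\<gamma> - 1) * (z * deriv G z + \<gamma> * G z) = of_real \<rho> powr (\<gamma> - 1) * (\<gamma> * g z)"
    unfolding D_def \<phi>_def z_eq[symmetric] by (simp add: z_eq algebra_simps)
  then show ?thesis using \<rho> by simp
qed

section \<open>Elementary estimates for a quotient of two numbers near 1\<close>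

text \<open>Split p/w = 1/w + (p - 1)/w. Expanding |w - 1|^2 <= m^2 bounds Re w, hence Re (1/w),
  from below in terms of |w|.\<close>

lemma Re_divide_ge:
  fixes p w :: complex
  assumes "norm (p - 1) < l" "norm (w - 1) \<le> m" "m < 1"
  shows "Re (p / w) > 1 / 2 + (1 - m\<^sup>2) / 2 * (1 / norm w)\<^sup>2 - l * (1 / norm w)"
proof -
  have w: "norm w > 0" using assms by auto
  have "(norm (w - 1))\<^sup>2 \<le> m\<^sup>2" using assms by (intro power_mono) auto
  then have "(norm w)\<^sup>2 + 1 - m\<^sup>2 \<le> 2 * Re w"
    unfolding cmod_power2 by (simp add: power2_eq_square algebra_simps)
  then have "((norm w)\<^sup>2 + 1 - m\<^sup>2) / 2 / (norm w)\<^sup>2 \<le> Re w / (norm w)\<^sup>2"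
    by (intro divide_right_mono) auto
  also have "Re w / (norm w)\<^sup>2 = Re (1 / w)"
    by (simp add: Re_divide cmod_power2)
  finally have 1: "1 / 2 + (1 - m\<^sup>2) / 2 * (1 / norm w)\<^sup>2 \<le> Re (1 / w)"
    using w by (simp add: field_simps power2_eq_square)
  have "norm ((p - 1) / w) < l * (1 / norm w)"
    using assms w by (simp add: norm_divide divide_strict_right_mono)
  then have "Re ((p - 1) / w) > - (l * (1 / norm w))"
    using abs_Re_le_cmod[of "(p - 1) / w"] by linarith
  moreover have "Re (p / w) = Re (1 / w) + Re ((p - 1) / w)"
    by (simp add: diff_divide_distrib)
  ultimately show ?thesis using 1 by linarith
qed

text \<open>Completing the square at the vertex t = l/(1 - m^2) gives the constant.\<close>

lemma Re_divide_gt_quadratic: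
  fixes p w :: complex
  assumes p: "norm (p - 1) < l" and w: "norm (w - 1) \<le> m" and m: "m < 1"
  shows "Re (p / w) > (1 - (l\<^sup>2 + m\<^sup>2)) / (2 * (1 - m\<^sup>2))"
proof -
  have m2: "1 - m\<^sup>2 > 0"
    using m w norm_ge_zero[of "w - 1"] by (simp add: abs_square_less_1 del: norm_ge_zero)
  define t where "t = 1 / norm w"
  have "1 / 2 + (1 - m\<^sup>2) / 2 * t\<^sup>2 - l * t - (1 - (l\<^sup>2 + m\<^sup>2)) / (2 * (1 - m\<^sup>2))
      = ((1 - m\<^sup>2) * t - l)\<^sup>2 / (2 * (1 - m\<^sup>2))"
    using m2 by (simp add: field_simps power2_eq_square)
  moreover have "((1 - m\<^sup>2) * t - l)\<^sup>2 / (2 * (1 - m\<^sup>2)) \<ge> 0" using m2 by simp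
  ultimately show ?thesis using Re_divide_ge[OF assms] unfolding t_def by linarith
qed

text \<open>The condition l + m <= 1 puts the vertex l/(1 - m^2) at or below 1/(1 + m), the least
  possible value of 1/|w|. The quadratic therefore increases on the admissible range and is smallest
  at that end point.\<close>

lemma Re_divide_gt_linear:
  fixes p w :: complex
  assumes p: "norm (p - 1) < l" and w: "norm (w - 1) \<le> m" and lm: "l + m \<le> 1"
  shows "Re (p / w) > (1 - l) / (1 + m)"
proof -
  have l0: "l > 0" and m0: "m \<ge> 0" using p w by (meson norm_ge_zero order_le_less_trans order_trans)+
  then have m: "m < 1" using lm by simp
  define t where "t = 1 / norm w"
  define t0 where "t0 = 1 / (1 + m)"
  have "w \<noteq> 0" using w m by auto
  moreover have "norm w \<le> 1 + m" using w norm_triangle_ineq[of "w - 1" 1] by simp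
  ultimately have tt: "t \<ge> t0" unfolding t_def t0_def using m0 by (simp add: frac_le)
  have t0m: "t0 * (1 + m) = 1" using m0 by (simp add: t0_def)
  have "(1 / 2 + (1 - m\<^sup>2) / 2 * t\<^sup>2 - l * t) - (1 / 2 + (1 - m\<^sup>2) / 2 * t0\<^sup>2 - l * t0)
      = (t - t0) * ((1 - m\<^sup>2) / 2 * (t + t0) - l)"
    by (simp add: field_simps power2_eq_square)
  also have "\<dots> \<ge> 0"
  proof (intro mult_nonneg_nonneg)
    have m2: "1 - m\<^sup>2 \<ge> 0" using m m0 by (simp add: abs_square_le_1)
    have "(1 - m\<^sup>2) / 2 * (t + t0) \<ge> (1 - m\<^sup>2) / 2 * (t0 + t0)"
      using tt m2 by (intro mult_left_mono) auto
    also have "(1 - m\<^sup>2) / 2 * (t0 + t0) = (1 - m) * (t0 * (1 + m))"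
      by (simp add: power2_eq_square field_simps)
    finally show "(1 - m\<^sup>2) / 2 * (t + t0) - l \<ge> 0" using t0m lm by simp
  qed (use tt in auto)
  finally have "1 / 2 + (1 - m\<^sup>2) / 2 * t\<^sup>2 - l * t \<ge> 1 / 2 + (1 - m\<^sup>2) / 2 * t0\<^sup>2 - l * t0" by simp
  also have "1 / 2 + (1 - m\<^sup>2) / 2 * t0\<^sup>2 - l * t0 = (1 - l) / (1 + m)"
    using m0 by (simp add: t0_def divide_simps power2_eq_square) (simp add: algebra_simps)
  ultimately show ?thesis using Re_divide_ge[OF p w m] unfolding t_def by linarith
qed

lemma norm_divide_minus_1_less:
  fixes p w :: complex
  assumes p: "norm (p - 1) < l" and w: "norm (w - 1) \<le> m" and m: "m < 1"
  shows "norm (p / w - 1) < (l + m) / (1 - m)"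
proof -
  have w0: "w \<noteq> 0" using w m by auto
  have wn: "norm w \<ge> 1 - m" using w norm_triangle_ineq2[of 1 "1 - w"] by (simp add: norm_minus_commute)
  have "norm (p - w) < l + m"
    using norm_triangle_ineq4[of "p - 1" "w - 1"] p w by simp
  then have "norm (p - w) / norm w < (l + m) / (1 - m)"
    using wn m by (intro frac_less) auto
  moreover have "p / w - 1 = (p - w) / w" using w0 by (simp add: field_simps)
  ultimately show ?thesis by (simp add: norm_divide)
qed

section \<open>The theorem on the transform F\<close>

theorem theorem3:
  fixes n :: nat and f L G M F :: "complex \<Rightarrow> complex" and lam \<mu> c :: complex
  assumes n: "n \<ge> 1"
    and fA: "class_A n f"
    and fnz: "\<forall>z\<in>ball 0 1 - {0}. f z \<noteq> 0"
    and lam: "lam \<noteq> 0" and mu: "\<mu> \<noteq> 0"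
    and cmu: "0 < Re (c - \<mu>)" "Re (c - \<mu>) < real n"
    \<comment> \<open>L is the branch of log(z/f(z)) analytic in U with L(0)=0; (z/f z)^a = exp(a L z)\<close>
    and L_hol: "L holomorphic_on ball 0 1" and L0: "L 0 = 0"
    and L_exp: "\<forall>z\<in>ball 0 1 - {0}. exp (L z) = z / f z"
    and sub: "subordinate (\<lambda>z. deriv f z * exp ((1 + \<mu>) * L z)) (\<lambda>z. 1 + lam * z)"
    \<comment> \<open>G(z) = (c-mu) z^{-(c-mu)} \<integral>_0^z (t/f t)^mu t^{c-mu-1} dt, segment t = s z\<close>
    and G_def: "\<forall>z. G z = (if z = 0 then 1 else
        (c - \<mu>) / (z powr (c - \<mu>)) *
        integral {0..1} (\<lambda>s::real. exp (\<mu> * L (of_real s * z)) *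
                                   (of_real s * z) powr (c - \<mu> - 1) * z))"
    and Gnz: "\<forall>z\<in>ball 0 1. G z \<noteq> 0"
    \<comment> \<open>M is the branch of log G analytic in U with M(0)=0; G^{-1/mu} = exp(-M/mu)\<close>
    and M_hol: "M holomorphic_on ball 0 1" and M0: "M 0 = 0"
    and M_exp: "\<forall>z\<in>ball 0 1. exp (M z) = G z"
    and F_def: "\<forall>z. F z = z * exp (- (1 / \<mu>) * M z)"
  shows
   "let Q = (\<lambda>z. if z = 0 then 1 else z * deriv F z / F z);
        a = cmod (of_nat n - \<mu>); b = cmod \<mu>;
        l1 = cmod lam * cmod (c - \<mu>) / cmod (of_nat n - (c - \<mu>));
        l2 = l1 * b / a
    in (Re \<mu> < real n \<and>
          cmod (c - \<mu>) * cmod lam \<le> a * cmod (of_nat n - (c - \<mu>)) / sqrt (a\<^sup>2 + b\<^sup>2)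
          \<longrightarrow> (\<forall>z\<in>ball 0 1. Re (Q z) > 0))
     \<and> (Re \<mu> < real n / 2 \<and> 0 < l1 \<and> l1 \<le> a / (a + b)
          \<longrightarrow> (\<forall>z\<in>ball 0 1. Re (Q z) > (1 - l1) / (1 + l2)))
     \<and> (Re \<mu> < real n / 2 \<and> a / (a + b) \<le> l1 \<and> l1 \<le> a / sqrt (a\<^sup>2 + b\<^sup>2)
          \<longrightarrow> (\<forall>z\<in>ball 0 1. Re (Q z) > (1 - (l1\<^sup>2 + l2\<^sup>2)) / (2 * (1 - l2\<^sup>2))))
     \<and> (Re \<mu> < real n / 2 \<and>
          cmod (c - \<mu>) * cmod lam \<le> cmod (of_nat n - (c - \<mu>)) * a / (a + 2 * b)
          \<longrightarrow> (\<forall>z\<in>ball 0 1.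
                cmod (Q z - 1) < (a + b) * cmod (c - \<mu>) * cmod lam /
                   (cmod (of_nat n - (c - \<mu>)) * a - cmod (c - \<mu>) * b * cmod lam))
              \<and> (a + b) * cmod (c - \<mu>) * cmod lam /
                   (cmod (of_nat n - (c - \<mu>)) * a - cmod (c - \<mu>) * b * cmod lam) \<le> 1)"
proof -
  define \<gamma> where "\<gamma> = c - \<mu>"
  define g where "g = (\<lambda>z. exp (\<mu> * L z))"
  define p where "p = (\<lambda>z. deriv f z * exp ((1 + \<mu>) * L z))"
  define P where "P = (\<lambda>z. G z - z * deriv G z / \<mu>)"
  have \<gamma>: "Re \<gamma> > 0" "Re \<gamma> < real n" "\<gamma> \<noteq> 0" using cmu by (auto simp: \<gamma>_def)
  have f_hol: "f holomorphic_on ball 0 1" and f0: "f 0 = 0" and f1: "deriv f 0 = 1"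
    and fk: "\<And>k. 2 \<le> k \<Longrightarrow> k \<le> n \<Longrightarrow> (deriv ^^ k) f 0 = 0"
    using fA by (auto simp: class_A_def)
  \<comment> \<open>Analyticity of G is inherited from its logarithm M.\<close>
  have G_hol: "G holomorphic_on ball 0 1"
    using M_exp by (intro holomorphic_transform[OF holomorphic_on_exp'[OF M_hol]]) auto
  have g_hol: "g holomorphic_on ball 0 1"
    unfolding g_def by (intro holomorphic_intros L_hol)
  note hol = f_hol G_hol g_hol L_hol
  have G0: "G 0 = 1" using G_def by simp
  have g0: "g 0 = 1" using L0 by (simp add: g_def)
  have fd: "(\<phi> has_field_derivative deriv \<phi> z) (at z)"
    if "\<phi> holomorphic_on ball 0 1" "z \<in> ball 0 1" for \<phi> :: "complex \<Rightarrow> complex" and z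
    using that holomorphic_derivI open_ball by blast

  \<comment> \<open>The vanishing derivatives of f begin at order 2, so powers of z are first
    extracted from f''. Two integrations, by the factor lemma with \<alpha> = 0, carry them to f' -
    1 and f - z, each gaining one power.\<close>
  obtain v where v: "v holomorphic_on ball 0 1"
    "\<And>z. z \<in> ball 0 1 \<Longrightarrow> deriv (deriv f) z = z ^ (n - 1) * v z"
  proof -
    have "(deriv ^^ k) (deriv (deriv f)) 0 = 0" if "k < n - 1" for k
      using fk[of "Suc (Suc k)"] that by (simp add: funpow_swap1)
    moreover have "deriv (deriv f) holomorphic_on ball 0 1"
      by (intro holomorphic_deriv f_hol open_ball)
    ultimately show ?thesis
      using holomorphic_factor_power[of "deriv (deriv f)" "n - 1"] that by blast
  qed
  obtain u1 where u1: "u1 holomorphic_on ball 0 1"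
    "\<And>z. z \<in> ball 0 1 \<Longrightarrow> deriv f z - 1 = z ^ n * u1 z"
  proof (rule Euler_operator_factor_power[of "\<lambda>z. deriv f z - 1" 0 v n])
    fix z :: complex assume "z \<in> ball 0 1"
    then show "z * deriv (\<lambda>z. deriv f z - 1) z + 0 * (deriv f z - 1) = z ^ n * v z"
      using v(2) n by (simp add: power_eq_if)
  qed (use f1 f_hol v in \<open>auto intro!: holomorphic_intros holomorphic_deriv\<close>)
  obtain u where u: "u holomorphic_on ball 0 1"
    "\<And>z. z \<in> ball 0 1 \<Longrightarrow> f z - z = z ^ Suc n * u z"
  proof (rule Euler_operator_factor_power[of "\<lambda>z. f z - z" 0 u1 "Suc n"])
    fix z :: complex assume z: "z \<in> ball 0 1"
    have "((\<lambda>z. f z - z) has_field_derivative deriv f z - 1) (at z)"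
      by (auto intro!: derivative_eq_intros fd f_hol z)
    then show "z * deriv (\<lambda>z. f z - z) z + 0 * (f z - z) = z ^ Suc n * u1 z"
      using u1(2)[OF z] by (simp add: DERIV_imp_deriv)
  qed (use f0 f_hol u1 in \<open>auto intro!: holomorphic_intros\<close>)

  \<comment> \<open>The logarithm L and the order of \<open>g - 1\<close> at 0\<close>
  have f_expL: "f z * exp (L z) = z" if "z \<in> ball 0 1" for z
    using L_exp fnz f0 that by (cases "z = 0") auto
  have zL': "z * deriv L z = 1 - deriv f z * exp (L z)" if z: "z \<in> ball 0 1" for z
  proof -
    have "((\<lambda>z. f z * exp (L z)) has_field_derivative
        deriv f z * exp (L z) + f z * exp (L z) * deriv L z) (at z)"
      by (auto intro!: derivative_eq_intros fd hol z)
    then have "((\<lambda>z. z) has_field_derivative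
        deriv f z * exp (L z) + f z * exp (L z) * deriv L z) (at z)"
      by (rule has_field_derivative_transform_within_open[OF _ open_ball z]) (use f_expL in auto)
    then have "deriv f z * exp (L z) + f z * exp (L z) * deriv L z = 1"
      using DERIV_unique DERIV_ident by blast
    then show ?thesis using f_expL[OF z] by (simp add: algebra_simps)
  qed
  have exp_mL: "exp (- L z) = 1 + z ^ n * u z" if z: "z \<in> ball 0 1" for z
  proof (cases "z = 0")
    case True
    then show ?thesis using L0 n by (simp add: power_0_left)
  next
    case False
    have "z * exp (- L z) = f z" using f_expL[OF z] by (simp add: exp_minus field_simps)
    also have "\<dots> = z * (1 + z ^ n * u z)" using u(2)[OF z] by (simp add: algebra_simps)
    finally show ?thesis using False by simp
  qed
  have zg': "z * deriv g z = \<mu> * g z * (1 - deriv f z * exp (L z))" if z: "z \<in> ball 0 1" for z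
  proof -
    have "(g has_field_derivative \<mu> * g z * deriv L z) (at z)"
      unfolding g_def by (auto intro!: derivative_eq_intros fd hol z)
    then have "z * deriv g z = \<mu> * g z * (z * deriv L z)" by (simp add: DERIV_imp_deriv)
    then show ?thesis using zL'[OF z] by simp
  qed
  obtain e where e: "e holomorphic_on ball 0 1"
    "\<And>z. z \<in> ball 0 1 \<Longrightarrow> g z - 1 = z ^ n * e z"
  \<comment> \<open>The witness comes from writing 1 as exp L (1 + z^n u) and f' as 1 + z^n u1 in
    the formula for zg'.\<close>
  proof (rule Euler_operator_factor_power[of "\<lambda>z. g z - 1" 0 "\<lambda>z. \<mu> * g z * exp (L z) * (u z - u1 z)" n])
    fix z :: complex assume z: "z \<in> ball 0 1"
    have "exp (L z) * (1 + z ^ n * u z) = 1"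
      using exp_mL[OF z] by (metis exp_minus_inverse)
    moreover have "deriv f z = 1 + z ^ n * u1 z" using u1(2)[OF z] by (simp add: algebra_simps)
    ultimately have "1 - deriv f z * exp (L z) = z ^ n * (exp (L z) * (u z - u1 z))"
      by (simp add: algebra_simps)
    then show "z * deriv (\<lambda>z. g z - 1) z + 0 * (g z - 1)
        = z ^ n * (\<mu> * g z * exp (L z) * (u z - u1 z))"
      using zg'[OF z] by simp
  qed (use g0 hol u u1 in \<open>auto intro!: holomorphic_intros\<close>)

  \<comment> \<open>Differential equations for G and P\<close>
  have ode: "z * deriv G z + \<gamma> * G z = \<gamma> * g z" if "z \<in> ball 0 1" for z
  proof (cases "z = 0")
    case False
    show ?thesis
    proof (rule integral_transform_ODE[OF g_hol G_hol])
      fix w :: complex assume "w \<in> ball 0 1 - {0}"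
      then show "G w = \<gamma> / w powr \<gamma> *
          integral {0..1} (\<lambda>s::real. g (of_real s * w) * (of_real s * w) powr (\<gamma> - 1) * w)"
        using G_def by (simp add: g_def \<gamma>_def)
    qed (use Gnz that False in auto)
  qed (use G0 g0 in auto)
  obtain k where k: "k holomorphic_on ball 0 1"
    "\<And>z. z \<in> ball 0 1 \<Longrightarrow> G z - 1 = z ^ n * k z"
  proof (rule Euler_operator_factor_power[of "\<lambda>z. G z - 1" \<gamma> "\<lambda>z. \<gamma> * e z" n])
    fix z :: complex assume z: "z \<in> ball 0 1"
    show "z * deriv (\<lambda>z. G z - 1) z + \<gamma> * (G z - 1) = z ^ n * (\<gamma> * e z)"
      using ode[OF z] e(2)[OF z] by (simp add: algebra_simps)
  qed (use G0 hol \<gamma> e in \<open>auto intro!: holomorphic_intros\<close>)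

  \<comment> \<open>P - 1 is -1/\<mu> times the Euler operator with \<alpha> = -\<mu> applied to G -
    1 = z^n k. \<open>h\<close> is what remains after removing z^n; \<open>mu_h\<close> later serves
    to bound k by h.\<close>
  define h where "h = (\<lambda>z. ((\<mu> - of_nat n) * k z - z * deriv k z) / \<mu>)"
  have mu_h: "(of_nat n - \<mu>) * k z + z * deriv k z = - \<mu> * h z" for z
    using mu by (simp add: h_def field_simps)
  have h_hol: "h holomorphic_on ball 0 1"
    unfolding h_def using mu by (intro holomorphic_intros holomorphic_deriv k) auto
  have P_eq: "P z - 1 = z ^ n * h z" if z: "z \<in> ball 0 1" for z
  proof -
    have "z * deriv G z - \<mu> * (G z - 1) = z ^ n * ((of_nat n - \<mu>) * k z + z * deriv k z)"
      using Euler_operator_power_mult[OF k(1) z k(2), where \<alpha> = "- \<mu>"] by simp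
    moreover have "z * deriv G z - \<mu> * (G z - 1) = - \<mu> * (P z - 1)"
      using mu by (simp add: P_def field_simps)
    ultimately have "- \<mu> * (P z - 1) = - \<mu> * (z ^ n * h z)"
      by (simp only: mu_h mult.left_commute)
    then show ?thesis using mu by simp
  qed
  \<comment> \<open>P arises from G by 1 - (z/\<mu>) d/dz, which commutes with z d/dz. The equation
    for G thus passes to P, with g replaced by g - zg'/\<mu> = p.\<close>
  have P_ode: "z * deriv P z + \<gamma> * (P z - 1) = \<gamma> * (p z - 1)" if z: "z \<in> ball 0 1" for z
  proof -
    have dG: "deriv G holomorphic_on ball 0 1" using G_hol by (simp add: holomorphic_deriv)
    have "((\<lambda>z. z * deriv G z + \<gamma> * G z) has_field_derivative
        deriv G z + z * deriv (deriv G) z + \<gamma> * deriv G z) (at z)"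
      by (auto intro!: derivative_eq_intros fd dG hol z)
    moreover have "((\<lambda>z. z * deriv G z + \<gamma> * G z) has_field_derivative \<gamma> * deriv g z) (at z)"
      by (rule has_field_derivative_transform_within_open[OF _ open_ball z, of "\<lambda>z. \<gamma> * g z"])
        (use ode z in \<open>auto intro!: derivative_eq_intros fd hol\<close>)
    ultimately have 1: "deriv G z + z * deriv (deriv G) z = \<gamma> * deriv g z - \<gamma> * deriv G z"
      using DERIV_unique by (metis add_diff_cancel_right')
    have "(P has_field_derivative deriv G z - (deriv G z + z * deriv (deriv G) z) / \<mu>) (at z)"
      unfolding P_def using mu by (auto intro!: derivative_eq_intros fd dG hol z)
    then have dP: "deriv P z = deriv G z - (\<gamma> * deriv g z - \<gamma> * deriv G z) / \<mu>"
      unfolding 1 by (rule DERIV_imp_deriv)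
    have "z * deriv P z + \<gamma> * P z = (z * deriv G z + \<gamma> * G z) - \<gamma> * (z * deriv g z) / \<mu>"
      unfolding dP using mu by (simp add: P_def field_simps)
    also have "\<dots> = \<gamma> * (g z * exp (L z) * deriv f z)"
      unfolding ode[OF z] zg'[OF z] using mu by (simp add: field_simps)
    also have "g z * exp (L z) * deriv f z = p z"
      by (simp add: p_def g_def exp_add distrib_right)
    finally show ?thesis by (simp add: algebra_simps)
  qed

  \<comment> \<open>Bounds for P - 1 and G - 1\<close>
  define K where "K = norm \<gamma> * norm lam / norm (of_nat n + \<gamma>)"
  have h_le: "norm (h z) \<le> K" if "z \<in> ball 0 1" for z
    unfolding K_def
  proof (rule norm_le_of_Euler_operator_bound[OF h_hol _ _ that, where n = n])
    fix z :: complex assume z: "z \<in> ball 0 1"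
    obtain w where "norm (w z) < 1" "p z = 1 + lam * w z"
      using sub z unfolding subordinate_def p_def by blast
    then have "norm (p z - 1) \<le> norm lam"
      by (simp add: norm_mult mult_left_le)
    moreover have "z ^ n * ((of_nat n + \<gamma>) * h z + z * deriv h z) = \<gamma> * (p z - 1)"
      using Euler_operator_power_mult[OF h_hol z P_eq, where \<alpha> = \<gamma>] P_ode[OF z] by simp
    ultimately show "norm (z ^ n * ((of_nat n + \<gamma>) * h z + z * deriv h z)) \<le> norm \<gamma> * norm lam"
      by (simp add: norm_mult mult_left_mono)
  qed (use \<gamma> in simp)
  have power_le: "norm (z ^ n * x) \<le> norm x" if "z \<in> ball 0 1" for z x :: complex
    using that by (simp add: norm_mult norm_power mult_left_le_one_le power_le_one)

  define a b N where "a = cmod (of_nat n - \<mu>)" and "b = cmod \<mu>" and "N = cmod (of_nat n - \<gamma>)"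
  define l1 l2 where "l1 = cmod lam * cmod \<gamma> / N" and "l2 = l1 * b / a"
  have N: "N > 0" using \<gamma> by (auto simp: N_def)
  have l1: "l1 > 0" using N lam \<gamma> by (simp add: l1_def)
  have b: "b > 0" using mu by (simp add: b_def)
  \<comment> \<open>The squares of |n + \<gamma>| and |n - \<gamma>| differ by 4n Re \<gamma> > 0.
    This strict gap is the source of the strict inequalities in the conclusions.\<close>
  have "K < l1"
  proof -
    have "(cmod (of_nat n - \<gamma>))\<^sup>2 < (cmod (of_nat n + \<gamma>))\<^sup>2"
      unfolding cmod_power2 using \<gamma> n by (simp add: power2_eq_square algebra_simps)
    then have "N < cmod (of_nat n + \<gamma>)" unfolding N_def by (rule power2_less_imp_less) simp
    moreover from this have "0 < N * cmod (of_nat n + \<gamma>)"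
      using N by (intro mult_pos_pos) linarith+
    ultimately show ?thesis
      unfolding K_def l1_def using lam \<gamma> by (auto simp: mult.commute intro!: divide_strict_left_mono)
  qed
  then have P_l1: "norm (P z - 1) < l1" if "z \<in> ball 0 1" for z
    using power_le[OF that, of "h z"] h_le[OF that] P_eq[OF that] by simp
  have G_l2: "norm (G z - 1) \<le> l2" if z: "z \<in> ball 0 1" and \<mu>: "Re \<mu> < real n" for z
  proof -
    \<comment> \<open>Second use of the maximum principle, now with \<alpha> = n - \<mu> and weight
      exponent 0, since the bound on h is already free of z^n.\<close>
    have "norm (k z) \<le> b * K / a"
      unfolding a_def
    proof (rule norm_le_of_Euler_operator_bound[OF k(1) _ _ z, where n = 0])
      fix w :: complex assume "w \<in> ball 0 1"
      then show "norm (w ^ 0 * ((of_nat n - \<mu>) * k w + w * deriv k w)) \<le> b * K"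
        unfolding mu_h using h_le by (simp add: b_def norm_mult mult_left_mono)
    qed (use \<mu> in simp)
    also have "\<dots> \<le> l2"
      unfolding l2_def using \<open>K < l1\<close> b by (simp add: a_def divide_right_mono mult.commute)
    finally show ?thesis using power_le[OF z, of "k z"] k(2)[OF z] by simp
  qed

  \<comment> \<open>The quotient zF'/F and the final estimates\<close>
  define Q where "Q = (\<lambda>z. if z = 0 then 1 else z * deriv F z / F z)"
  have Q: "Q z = P z / G z" if z: "z \<in> ball 0 1" for z
  proof (cases "z = 0")
    case True
    then show ?thesis by (simp add: Q_def P_def G0)
  next
    \<comment> \<open>Logarithmic differentiation gives zF'/F = 1 - zM'/\<mu> and G' = G M', hence P
      = QG.\<close>
    case False
    have F_eq: "F = (\<lambda>z. z * exp (- (1 / \<mu>) * M z))" using F_def by auto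
    have "(F has_field_derivative exp (- (1 / \<mu>) * M z) * (1 - z * deriv M z / \<mu>)) (at z)"
      unfolding F_eq using mu by (auto intro!: derivative_eq_intros fd M_hol z simp: algebra_simps)
    then have Qz: "Q z = 1 - z * deriv M z / \<mu>"
      using False by (simp add: Q_def DERIV_imp_deriv F_def)
    have G': "deriv G z = G z * deriv M z"
    proof (rule DERIV_imp_deriv, rule has_field_derivative_transform_within_open[OF _ open_ball z])
      show "((\<lambda>z. exp (M z)) has_field_derivative G z * deriv M z) (at z)"
        using M_exp z by (auto intro!: derivative_eq_intros fd M_hol)
    qed (use M_exp in auto)
    have "P z = Q z * G z" unfolding P_def Qz G' by (simp add: algebra_simps)
    then show ?thesis using Gnz z by simp
  qed

  have a_pos: "a > 0" if "Re \<mu> < real n"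
    using that by (auto simp: a_def)
  have l2_nonneg: "l2 \<ge> 0" using l1 b by (simp add: l2_def a_def)
  \<comment> \<open>Since l2 = l1 b/a, the sum of squares is l1^2 (a^2 + b^2)/a^2, so the square
    root in the hypothesis encodes exactly \<open>l1\<^sup>2 + l2\<^sup>2 \<le> 1\<close>.\<close>
  have sq: "l1\<^sup>2 + l2\<^sup>2 \<le> 1 \<and> l2 < 1" if "Re \<mu> < real n" "l1 \<le> a / sqrt (a\<^sup>2 + b\<^sup>2)"
  proof -
    note a = a_pos[OF that(1)]
    have "l1\<^sup>2 \<le> (a / sqrt (a\<^sup>2 + b\<^sup>2))\<^sup>2" using that l1 by (intro power_mono) auto
    then have "l1\<^sup>2 * (a\<^sup>2 + b\<^sup>2) \<le> a\<^sup>2" using a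
      by (simp add: power_divide pos_le_divide_eq add_pos_nonneg)
    then have le: "l1\<^sup>2 + l2\<^sup>2 \<le> 1"
      using a unfolding l2_def by (simp add: power_divide power_mult_distrib field_simps)
    then have "l2\<^sup>2 < 1" using l1 zero_less_power[OF l1, of 2] by linarith
    then show ?thesis using le l2_nonneg by (simp add: abs_square_less_1)
  qed
  have lin: "l1 + l2 \<le> 1" if "Re \<mu> < real n" "l1 \<le> a / (a + b)"
    using that a_pos b l1 unfolding l2_def by (simp add: field_simps)
  have quad_bound: "Re (Q z) > (1 - (l1\<^sup>2 + l2\<^sup>2)) / (2 * (1 - l2\<^sup>2))"
    if "Re \<mu> < real n" "l1 \<le> a / sqrt (a\<^sup>2 + b\<^sup>2)" "z \<in> ball 0 1" for z
    using Re_divide_gt_quadratic[OF P_l1 G_l2] sq that Q by auto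

  have n2: "Re \<mu> < real n" if "Re \<mu> < real n / 2" using that n by linarith
  \<comment> \<open>The quadratic lower bound is strict, so it is enough that its constant be
    nonnegative.\<close>
  have 1: "Re (Q z) > 0"
    if "Re \<mu> < real n" "cmod \<gamma> * cmod lam \<le> a * N / sqrt (a\<^sup>2 + b\<^sup>2)" "z \<in> ball 0 1" for z
  proof -
    have "l1 \<le> a / sqrt (a\<^sup>2 + b\<^sup>2)" using that N by (simp add: l1_def field_simps)
    note * = quad_bound[OF that(1) this that(3)] sq[OF that(1) this]
    have "l2\<^sup>2 < 1" using * l2_nonneg by (simp add: abs_square_less_1)
    then have "(1 - (l1\<^sup>2 + l2\<^sup>2)) / (2 * (1 - l2\<^sup>2)) \<ge> 0" using * by simp
    then show ?thesis using * by linarith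
  qed
  have 2: "Re (Q z) > (1 - l1) / (1 + l2)"
    if "Re \<mu> < real n / 2" "l1 \<le> a / (a + b)" "z \<in> ball 0 1" for z
    using Re_divide_gt_linear[OF P_l1 G_l2] lin that n2 Q by auto
  define R where "R = (a + b) * cmod \<gamma> * cmod lam / (N * a - cmod \<gamma> * b * cmod lam)"
  have 3: "(\<forall>z\<in>ball 0 1. cmod (Q z - 1) < R) \<and> R \<le> 1"
    if "Re \<mu> < real n / 2" "cmod \<gamma> * cmod lam \<le> N * a / (a + 2 * b)"
  proof -
    note a = a_pos[OF n2[OF that(1)]]
    have "l1 \<le> a / (a + 2 * b)" using that N by (simp add: l1_def field_simps)
    \<comment> \<open>After cancelling N a, R becomes (l1 + l2)/(1 - l2), and R <= 1 is this
      inequality.\<close>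
    then have l12: "l1 + 2 * l2 \<le> 1" using a b unfolding l2_def by (simp add: field_simps)
    have "cmod \<gamma> * cmod lam = l1 * N" using N by (simp add: l1_def)
    then have "R = (a + b) * (l1 * N) / (N * a - b * (l1 * N))"
      by (simp add: R_def mult_ac)
    also have "(a + b) * (l1 * N) = N * a * (l1 + l2)"
      using a by (simp add: l2_def field_simps)
    also have "N * a - b * (l1 * N) = N * a * (1 - l2)"
      using a by (simp add: l2_def field_simps)
    also have "N * a * (l1 + l2) / (N * a * (1 - l2)) = (l1 + l2) / (1 - l2)" using a N by simp
    finally have R: "R = (l1 + l2) / (1 - l2)" .
    have "l2 < 1" using l12 l1 l2_nonneg by linarith
    then have "R \<le> 1" using l12 by (simp add: R)
    moreover have "cmod (Q z - 1) < R" if "z \<in> ball 0 1" for z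
      using norm_divide_minus_1_less[OF P_l1 G_l2] \<open>l2 < 1\<close> n2 that \<open>Re \<mu> < real n / 2\<close> Q R by auto
    ultimately show ?thesis by blast
  qed
  show ?thesis
    unfolding Let_def
    using 1 2 3 quad_bound n2
    unfolding Q_def R_def l2_def l1_def a_def b_def N_def \<gamma>_def by blast
qed

end
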